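(* Let $E,E_1$ be regular spaces of measurable functions and let $\nu$ denote the measure of nonequiabsolute continuity (in $E$ and in $E_1$). (i) Let $u_1\in E$ and let $f,A_1,A_0\colon E\to E_1$ be continuous operators such that $f(u_1+u)=A_1(u)+A_0(u)$ for all $u\in E$ with $\|u\|$ sufficiently small, $A_0$ is locally strongly $\nu$-condensing at the point $\theta$, and there is $0<k\leqslant1$ with $\nu(A_1(\rho U))=\rho^k\nu(A_1(U))$ for all $U\subset E$ and all $\rho>0$. Then $A_1$ is improving if and only if $f\in(\lambda_2)$ (i.e. $f$ is locally strongly $\nu$-condensing at $u_1$), and if and only if $f\in(\lambda_3)$ (i.e. $f$ is locally strongly $\nu$-condensing at $u_1$ on spheres). (ii) Let $f,\tilde A_1,\tilde A_0\colon E\to E_1$ be continuous operators such that $f(u)=\tilde A_1(u)+\tilde A_0(u)$ for all $u\in E$ with $\|u\|$ sufficiently large, $\tilde A_0$ is strongly $\nu$-condensing at infinity on spherical interlayers, and there is $k\geqslant1$ with $\nu(\tilde A_1(\rho U))=\rho^k\nu(\tilde A_1(U))$ for all $U\subset E$ and all $\rho>0$. Then $\tilde A_1$ is improving if and only if $f\in(\tilde\lambda_2)$ (i.e. $f$ is strongly $\nu$-condensing at infinity on spherical interlayers), and if and only if $f\in(\tilde\lambda_3)$ (i.e. $f$ is strongly $\nu$-condensing at infinity on spheres).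
   Context: Notation: $\theta$ is the zero element; $S_\rho=\{u\in E:\|u\|=\rho\}$, $B_\rho=\{u\in E:\|u\|\leqslant\rho\}$. Let $\Omega\subset\mathbb R^n$ with a measure $\mu$, $\mu(\Omega)<\infty$, which is continuous: every measurable $D\subset\Omega$ with $\mu(D)>0$ is a disjoint union $D=D_1\cup D_2$ with $\mu(D_1)=\mu(D_2)=\mu(D)/2$. For measurable $D\subseteq\Omega$ let $P_D$ be the operator $(P_Du)(s)=u(s)$ for $s\in D$ and $(P_Du)(s)=0$ for $s\notin D$. A regular space is a Banach space $E$ of (classes of) measurable functions on $\Omega$ such that (ideal property) if $v\in E$, $u$ is measurable and $|u|\leqslant|v|$ a.e., then $u\in E$ and $\|u\|\leqslant\|v\|$, and (regularity) every $u\in E$ has absolutely continuous norm: $\|P_Du\|_E\to0$ as $\mu(D)\to0$. For example, $L_p(\Omega)$ with $1\leqslant p<\infty$ is regular. The measure of nonequiabsolute continuity of the norms of elements of $U\subset E$ is $$\nu(U)=\nu_E(U)=\limsup_{\mu(D)\to0}\ \sup_{u\in U}\|P_Du\|_E\in[0,+\infty],$$ and similarly in $E_1$. An operator $T\colon E\to E_1$ is improving if $\nu(T(U))=0$ for every bounded $U\subset E$. Classes of continuous operators $f\colon E\to E_1$: Locally strongly $\nu$-condensing at $u_1\in E$ (class $(\lambda_2)$): there exist $r_1>0$ and a nonnegative function $\lambda_{u_1,f}$ on $[0,r_1]$ with $\lim_{r\to0}\lambda_{u_1,f}(r)=0$ such that $\nu_{E_1}(f(U))\leqslant\lambda_{u_1,f}(r)\,\nu_E(U)$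 for all $0<\rho<r<r_1$ and $U=u_1+B_\rho$. Locally strongly $\nu$-condensing at $u_1$ on spheres (class $(\lambda_3)$): the same with $U=u_1+S_\rho$ instead of $U=u_1+B_\rho$. Strongly $\nu$-condensing at infinity on spherical interlayers (class $(\tilde\lambda_2)$): there exist $R_f>0$ and a nonnegative function $\tilde\lambda_f$ on $[R_f,\infty)$ with $\lim_{r\to\infty}\tilde\lambda_f(r)=0$ such that $\nu_{E_1}(f(U))\leqslant\tilde\lambda_f(R_1)\,\nu_E(U)$ for all $R_2>R_1>R_f$ and $U=B_{R_2}\setminus B_{R_1}$. Strongly $\nu$-condensing at infinity on spheres (class $(\tilde\lambda_3)$): the same with $U=S_{R_2}$ instead of $U=B_{R_2}\setminus B_{R_1}$. *)

theory Defs
  imports "HOL-Analysis.Analysis"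
begin

definition continuous_measure :: "'a measure \<Rightarrow> bool" where
  "continuous_measure M \<longleftrightarrow>
     (\<forall>D\<in>sets M. measure M D > 0 \<longrightarrow>
        (\<exists>D1\<in>sets M. \<exists>D2\<in>sets M. D = D1 \<union> D2 \<and> D1 \<inter> D2 = {} \<and>
           measure M D1 = measure M D / 2 \<and> measure M D2 = measure M D / 2))"

text \<open>
  The filter ``\<open>D\<close> measurable, \<open>\<mu>(D) \<rightarrow> 0\<close>''. Null sets are included; they contribute
  nothing to the quantities below because \<open>P\<^sub>D u\<close> is then the zero class.
\<close>

definition small_sets :: "'a measure \<Rightarrow> 'a set filter" where
  "small_sets M = inf (filtercomap (emeasure M) (nhds 0)) (principal (sets M))"

lemma eventually_small_sets:
  "eventually P (small_sets M) \<longleftrightarrow>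
     (\<exists>\<delta>>0. \<forall>D\<in>sets M. emeasure M D < \<delta> \<longrightarrow> P D)"
proof -
  have "eventually Q (nhds (0::ennreal)) \<longleftrightarrow> (\<exists>\<delta>>0. \<forall>x<\<delta>. Q x)" for Q
  proof
    assume "eventually Q (nhds (0::ennreal))"
    then obtain S where S: "open S" "0 \<in> S" "\<forall>x\<in>S. Q x"
      by (auto simp: eventually_nhds)
    from open_right[OF S(1,2), of 1] obtain b where "b > 0" "{0..<b} \<subseteq> S"
      by auto
    then show "\<exists>\<delta>>0. \<forall>x<\<delta>. Q x"
      using S(3) by (intro exI[of _ b]) auto
  next
    assume "\<exists>\<delta>>0. \<forall>x<\<delta>. Q x"
    then obtain \<delta> where "\<delta> > 0" "\<forall>x<\<delta>. Q x" by blast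
    then show "eventually Q (nhds (0::ennreal))"
      by (auto simp: eventually_nhds intro!: exI[of _ "{..<\<delta>}"])
  qed
  note nhds0 = this
  show ?thesis
    unfolding small_sets_def eventually_inf_principal eventually_filtercomap nhds0
  proof
    assume "\<exists>Q. (\<exists>\<delta>>0. \<forall>x<\<delta>. Q x) \<and> (\<forall>x. Q (emeasure M x) \<longrightarrow> x \<in> sets M \<longrightarrow> P x)"
    then show "\<exists>\<delta>>0. \<forall>D\<in>sets M. emeasure M D < \<delta> \<longrightarrow> P D" by blast
  next
    assume "\<exists>\<delta>>0. \<forall>D\<in>sets M. emeasure M D < \<delta> \<longrightarrow> P D"
    then obtain \<delta> where "\<delta> > 0" "\<forall>D\<in>sets M. emeasure M D < \<delta> \<longrightarrow> P D" by blast
    then show "\<exists>Q. (\<exists>\<delta>>0. \<forall>x<\<delta>. Q x) \<and> (\<forall>x. Q (emeasure M x) \<longrightarrow> x \<in> sets M \<longrightarrow> P x)"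
      by (intro exI[of _ "\<lambda>x. x < \<delta>"]) blast
  qed
qed

text \<open>
  A Banach space of classes of measurable functions on \<open>\<Omega> = space M\<close> is a Banach type
  \<open>'e\<close> whose elements play the role of the classes; \<open>rep u\<close> is a representative of the
  class \<open>u\<close>. So equality in \<open>'e\<close> is equality almost everywhere, and the linear structure
  of \<open>'e\<close> is the pointwise one almost everywhere.
\<close>

definition restr :: "'a measure \<Rightarrow> ('e \<Rightarrow> 'a \<Rightarrow> real) \<Rightarrow> 'a set \<Rightarrow> 'e \<Rightarrow> 'e" where
  "restr M rep D u = (THE w. AE s in M. rep w s = (if s \<in> D then rep u s else 0))"

locale regular_function_space =
  fixes M :: "'a measure" and rep :: "'e::banach \<Rightarrow> 'a \<Rightarrow> real"
  assumes rep_measurable: "rep u \<in> borel_measurable M"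
    and rep_eqI: "(AE s in M. rep u s = rep v s) \<Longrightarrow> u = v"
    and rep_add: "AE s in M. rep (u + v) s = rep u s + rep v s"
    and rep_scaleR: "AE s in M. rep (c *\<^sub>R u) s = c * rep u s"
    and ideal: "g \<in> borel_measurable M \<Longrightarrow> (AE s in M. \<bar>g s\<bar> \<le> \<bar>rep v s\<bar>) \<Longrightarrow>
      \<exists>w. (AE s in M. rep w s = g s) \<and> norm w \<le> norm v"
    and absolutely_continuous_norm: "((\<lambda>D. norm (restr M rep D u)) \<longlongrightarrow> 0) (small_sets M)"

lemma (in regular_function_space) rep_restr:
  assumes "D \<in> sets M"
  shows "AE s in M. rep (restr M rep D u) s = (if s \<in> D then rep u s else 0)"
proof -
  have "(\<lambda>s. if s \<in> D then rep u s else 0) \<in> borel_measurable M"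
    using assms rep_measurable[of u] by (intro measurable_If_set) auto
  from ideal[OF this, of u] obtain w
    where w: "AE s in M. rep w s = (if s \<in> D then rep u s else 0)" by auto
  show ?thesis
    unfolding restr_def
  proof (rule theI[of _ w])
    fix v assume "AE s in M. rep v s = (if s \<in> D then rep u s else 0)"
    with w have "AE s in M. rep v s = rep w s" by eventually_elim simp
    then show "v = w" by (rule rep_eqI)
  qed (fact w)
qed

definition nu :: "'a measure \<Rightarrow> ('e::banach \<Rightarrow> 'a \<Rightarrow> real) \<Rightarrow> 'e set \<Rightarrow> ennreal" where
  "nu M rep U = Limsup (small_sets M) (\<lambda>D. SUP u\<in>U. ennreal (norm (restr M rep D u)))"

definition improving ::
  "'a measure \<Rightarrow> ('e::banach \<Rightarrow> 'a \<Rightarrow> real) \<Rightarrow> ('e1::banach \<Rightarrow> 'a \<Rightarrow> real) \<Rightarrow> ('e \<Rightarrow> 'e1) \<Rightarrow> bool"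
  where
  "improving M rep rep1 T \<longleftrightarrow> (\<forall>U. bounded U \<longrightarrow> nu M rep1 (T ` U) = 0)"

definition locally_strongly_condensing ::
  "'a measure \<Rightarrow> ('e::banach \<Rightarrow> 'a \<Rightarrow> real) \<Rightarrow> ('e1::banach \<Rightarrow> 'a \<Rightarrow> real) \<Rightarrow> 'e \<Rightarrow> ('e \<Rightarrow> 'e1) \<Rightarrow> bool"
  where
  "locally_strongly_condensing M rep rep1 u1 f \<longleftrightarrow>
     (\<exists>r1>0. \<exists>l :: real \<Rightarrow> real. (\<forall>r\<in>{0..r1}. l r \<ge> 0) \<and> (l \<longlongrightarrow> 0) (at_right 0) \<and>
        (\<forall>\<rho> r. 0 < \<rho> \<and> \<rho> < r \<and> r < r1 \<longrightarrow>
           nu M rep1 (f ` ((+) u1 ` cball 0 \<rho>)) \<le> ennreal (l r) * nu M rep ((+) u1 ` cball 0 \<rho>)))"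

definition locally_strongly_condensing_on_spheres ::
  "'a measure \<Rightarrow> ('e::banach \<Rightarrow> 'a \<Rightarrow> real) \<Rightarrow> ('e1::banach \<Rightarrow> 'a \<Rightarrow> real) \<Rightarrow> 'e \<Rightarrow> ('e \<Rightarrow> 'e1) \<Rightarrow> bool"
  where
  "locally_strongly_condensing_on_spheres M rep rep1 u1 f \<longleftrightarrow>
     (\<exists>r1>0. \<exists>l :: real \<Rightarrow> real. (\<forall>r\<in>{0..r1}. l r \<ge> 0) \<and> (l \<longlongrightarrow> 0) (at_right 0) \<and>
        (\<forall>\<rho> r. 0 < \<rho> \<and> \<rho> < r \<and> r < r1 \<longrightarrow>
           nu M rep1 (f ` ((+) u1 ` sphere 0 \<rho>)) \<le> ennreal (l r) * nu M rep ((+) u1 ` sphere 0 \<rho>)))"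

definition strongly_condensing_at_infinity_on_interlayers ::
  "'a measure \<Rightarrow> ('e::banach \<Rightarrow> 'a \<Rightarrow> real) \<Rightarrow> ('e1::banach \<Rightarrow> 'a \<Rightarrow> real) \<Rightarrow> ('e \<Rightarrow> 'e1) \<Rightarrow> bool"
  where
  "strongly_condensing_at_infinity_on_interlayers M rep rep1 f \<longleftrightarrow>
     (\<exists>Rf>0. \<exists>l :: real \<Rightarrow> real. (\<forall>r\<in>{Rf..}. l r \<ge> 0) \<and> (l \<longlongrightarrow> 0) at_top \<and>
        (\<forall>R1 R2. R2 > R1 \<and> R1 > Rf \<longrightarrow>
           nu M rep1 (f ` (cball 0 R2 - cball 0 R1)) \<le> ennreal (l R1) * nu M rep (cball 0 R2 - cball 0 R1)))"

definition strongly_condensing_at_infinity_on_spheres ::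
  "'a measure \<Rightarrow> ('e::banach \<Rightarrow> 'a \<Rightarrow> real) \<Rightarrow> ('e1::banach \<Rightarrow> 'a \<Rightarrow> real) \<Rightarrow> ('e \<Rightarrow> 'e1) \<Rightarrow> bool"
  where
  "strongly_condensing_at_infinity_on_spheres M rep rep1 f \<longleftrightarrow>
     (\<exists>Rf>0. \<exists>l :: real \<Rightarrow> real. (\<forall>r\<in>{Rf..}. l r \<ge> 0) \<and> (l \<longlongrightarrow> 0) at_top \<and>
        (\<forall>R1 R2. R2 > R1 \<and> R1 > Rf \<longrightarrow>
           nu M rep1 (f ` sphere 0 R2) \<le> ennreal (l R1) * nu M rep (sphere 0 R2)))"

end

theory Submission
  imports Defs
begin

text \<open>
  If the principal part \<open>A1\<close> is improving, it contributes nothing to \<open>\<nu>\<close>, and \<open>f\<close> inherits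
  the estimates of \<open>A0\<close>; passing between balls and spheres costs nothing, because
  \<open>\<nu>(B\<^sub>\<rho>) = \<nu>(S\<^sub>\<rho>)\<close> and \<open>\<nu>\<close> is translation invariant. Conversely, the condensing property on
  spheres gives \<open>\<rho>\<^sup>k \<nu>(A1(S\<^sub>1)) = \<nu>(A1(S\<^sub>\<rho>)) \<le> o(1) \<rho>\<close>, and letting \<open>\<rho>\<close> tend to zero
  (\<open>k \<le> 1\<close>) or to infinity (\<open>k \<ge> 1\<close>) yields \<open>\<nu>(A1(S\<^sub>1)) = 0\<close>. The remaining step, from all
  spheres to balls, uses Baire's theorem in the radius and the homogeneity of \<open>\<nu>(A1(\<cdot>))\<close>.
\<close>

section \<open>Small sets and the restriction operators\<close>

lemma eventually_small_setsI:
  assumes "\<And>D. D \<in> sets M \<Longrightarrow> P D"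
  shows "eventually P (small_sets M)"
  unfolding eventually_small_sets using assms by (intro exI[of _ 1]) auto

context regular_function_space
begin

text \<open>Classes that agree almost everywhere are equal, so identities for the definite
  description \<open>restr\<close> can be checked pointwise almost everywhere.\<close>

lemma restr_eqI:
  assumes "AE s in M. rep w s = (if s \<in> D then rep u s else 0)"
  shows "restr M rep D u = w"
  unfolding restr_def
proof (rule the_equality)
  fix v assume "AE s in M. rep v s = (if s \<in> D then rep u s else 0)"
  with assms have "AE s in M. rep v s = rep w s" by eventually_elim simp
  then show "v = w" by (rule rep_eqI)
qed (fact assms)

lemma restr_add:
  assumes "D \<in> sets M"
  shows "restr M rep D (u + v) = restr M rep D u + restr M rep D v"
proof (rule restr_eqI)
  show "AE s in M. rep (restr M rep D u + restr M rep D v) s = (if s \<in> D then rep (u + v) s else 0)"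
    using rep_add[of "restr M rep D u" "restr M rep D v"] rep_add[of u v]
      rep_restr[OF assms, of u] rep_restr[OF assms, of v]
    by eventually_elim simp
qed

lemma restr_scaleR:
  assumes "D \<in> sets M"
  shows "restr M rep D (c *\<^sub>R u) = c *\<^sub>R restr M rep D u"
proof (rule restr_eqI)
  show "AE s in M. rep (c *\<^sub>R restr M rep D u) s = (if s \<in> D then rep (c *\<^sub>R u) s else 0)"
    using rep_scaleR[of c "restr M rep D u"] rep_scaleR[of c u] rep_restr[OF assms, of u]
    by eventually_elim simp
qed

lemma norm_restr_le:
  assumes "D \<in> sets M"
  shows "norm (restr M rep D u) \<le> norm u"
proof -
  have "(\<lambda>s. if s \<in> D then rep u s else 0) \<in> borel_measurable M"
    using assms rep_measurable[of u] by (intro measurable_If_set) auto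
  from ideal[OF this, of u] obtain w
    where w: "AE s in M. rep w s = (if s \<in> D then rep u s else 0)" "norm w \<le> norm u" by auto
  with restr_eqI[OF w(1)] show ?thesis by simp
qed

lemma bounded_linear_restr:
  assumes "D \<in> sets M"
  shows "bounded_linear (restr M rep D)"
  by (rule bounded_linear_intro[of _ 1])
     (use assms in \<open>simp_all add: restr_add restr_scaleR norm_restr_le\<close>)

section \<open>Calculus of the measure of nonequiabsolute continuity\<close>

lemma nu_leI:
  assumes "\<forall>\<^sub>F D in small_sets M. \<forall>u\<in>U. norm (restr M rep D u) \<le> c"
  shows "nu M rep U \<le> ennreal c"
  unfolding nu_def
  by (rule Limsup_bounded, rule eventually_mono[OF assms]) (auto intro!: SUP_least ennreal_leI)

text \<open>With \<open>nu_leI\<close> this trades the limit superior for one real bound, uniform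
  over \<open>U\<close>, on all sets of small measure. Only a strict bound on a limit superior holds
  eventually.\<close>

lemma nu_lessD:
  assumes "nu M rep U < ennreal c"
  shows "\<forall>\<^sub>F D in small_sets M. \<forall>u\<in>U. norm (restr M rep D u) \<le> c"
proof -
  have c: "c \<ge> 0"
  proof (rule ccontr)
    assume "\<not> c \<ge> 0"
    then have "ennreal c = 0" by (simp add: ennreal_neg)
    with assms show False by simp
  qed
  from assms have "\<forall>\<^sub>F D in small_sets M. (SUP u\<in>U. ennreal (norm (restr M rep D u))) < ennreal c"
    unfolding nu_def by (rule Limsup_lessD)
  then show ?thesis
  proof (rule eventually_mono, intro ballI)
    fix D u assume "(SUP u\<in>U. ennreal (norm (restr M rep D u))) < ennreal c" "u \<in> U"
    then have "ennreal (norm (restr M rep D u)) < ennreal c" by (rule SUP_lessD)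
    then show "norm (restr M rep D u) \<le> c" using c by (simp add: ennreal_less_iff)
  qed
qed

text \<open>When both values on the right are finite, the bounds \<open>v + e / 2\<close> and
  \<open>w + e / 2\<close> hold on the same small sets and add up. Sums and differences are both
  instances.\<close>

lemma nu_le_add:
  assumes "\<And>x. x \<in> U \<Longrightarrow> \<exists>a\<in>V. \<exists>b\<in>W. \<forall>D\<in>sets M.
      norm (restr M rep D x) \<le> norm (restr M rep D a) + norm (restr M rep D b)"
  shows "nu M rep U \<le> nu M rep V + nu M rep W"
proof (rule ennreal_le_epsilon)
  fix e :: real assume fin: "nu M rep V + nu M rep W < top" and e: "e > 0"
  obtain v where v: "v \<ge> 0" "nu M rep V = ennreal v"
    using fin by (cases "nu M rep V") auto
  obtain w where w: "w \<ge> 0" "nu M rep W = ennreal w"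
    using fin by (cases "nu M rep W") auto
  have *: "\<forall>\<^sub>F D in small_sets M. D \<in> sets M" by (rule eventually_small_setsI)
  have "nu M rep V < ennreal (v + e / 2)" "nu M rep W < ennreal (w + e / 2)"
    using v w e by (simp_all add: ennreal_lessI)
  from this[THEN nu_lessD] *
  have "\<forall>\<^sub>F D in small_sets M. \<forall>x\<in>U. norm (restr M rep D x) \<le> v + w + e"
  proof eventually_elim
    case (elim D)
    show ?case
    proof
      fix x assume "x \<in> U"
      then obtain a b where "a \<in> V" "b \<in> W"
        "norm (restr M rep D x) \<le> norm (restr M rep D a) + norm (restr M rep D b)"
        using assms elim(3) by blast
      with elim have "norm (restr M rep D a) \<le> v + e / 2" "norm (restr M rep D b) \<le> w + e / 2"
        "norm (restr M rep D x) \<le> norm (restr M rep D a) + norm (restr M rep D b)"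
        by blast+
      then show "norm (restr M rep D x) \<le> v + w + e" by linarith
    qed
  qed
  then have "nu M rep U \<le> ennreal (v + w + e)" by (rule nu_leI)
  then show "nu M rep U \<le> nu M rep V + nu M rep W + ennreal e"
    using v w e by (simp add: ennreal_plus)
qed

lemma nu_add:
  "nu M rep ((\<lambda>x. f x + g x) ` U) \<le> nu M rep (f ` U) + nu M rep (g ` U)"
proof (rule nu_le_add)
  fix x assume "x \<in> (\<lambda>x. f x + g x) ` U"
  then obtain u where "u \<in> U" "x = f u + g u" by auto
  then show "\<exists>a\<in>f ` U. \<exists>b\<in>g ` U. \<forall>D\<in>sets M.
      norm (restr M rep D x) \<le> norm (restr M rep D a) + norm (restr M rep D b)"
    by (auto simp: restr_add intro!: norm_triangle_ineq bexI[of _ u])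
qed

lemma nu_diff:
  "nu M rep ((\<lambda>x. f x - g x) ` U) \<le> nu M rep (f ` U) + nu M rep (g ` U)"
proof (rule nu_le_add)
  fix x assume "x \<in> (\<lambda>x. f x - g x) ` U"
  then obtain u where "u \<in> U" "x = f u - g u" by auto
  then show "\<exists>a\<in>f ` U. \<exists>b\<in>g ` U. \<forall>D\<in>sets M.
      norm (restr M rep D x) \<le> norm (restr M rep D a) + norm (restr M rep D b)"
    by (auto simp: linear_diff[OF bounded_linear.linear[OF bounded_linear_restr]]
        intro!: norm_triangle_ineq4 bexI[of _ u])
qed

lemma nu_mono: "U \<subseteq> V \<Longrightarrow> nu M rep U \<le> nu M rep V"
  unfolding nu_def by (intro Limsup_mono always_eventually allI SUP_subset_mono) auto

text \<open>The supremum over a union is the larger of the two suprema, and any \<open>y\<close>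
  strictly above both limits superior eventually exceeds both suprema.\<close>

lemma nu_Un: "nu M rep (U \<union> V) \<le> max (nu M rep U) (nu M rep V)"
  unfolding nu_def Limsup_le_iff
proof (intro allI impI)
  fix y :: ennreal
  let ?S = "\<lambda>U D. SUP u\<in>U. ennreal (norm (restr M rep D u))"
  assume "max (Limsup (small_sets M) (?S U)) (Limsup (small_sets M) (?S V)) < y"
  then have "\<forall>\<^sub>F D in small_sets M. ?S U D < y" "\<forall>\<^sub>F D in small_sets M. ?S V D < y"
    by (auto intro: Limsup_lessD)
  then show "\<forall>\<^sub>F D in small_sets M. ?S (U \<union> V) D < y"
    by eventually_elim (simp add: SUP_union sup_max)
qed

lemma nu_bounded_le:
  assumes "U \<subseteq> cball 0 \<rho>"
  shows "nu M rep U \<le> ennreal \<rho>"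
proof (intro nu_leI eventually_small_setsI ballI)
  fix D u assume "D \<in> sets M" "u \<in> U"
  then show "norm (restr M rep D u) \<le> \<rho>"
    using assms norm_restr_le[of D u] by fastforce
qed

text \<open>This is the regularity axiom expressed through \<open>nu\<close>. It makes constant
  summands invisible and thus yields translation invariance.\<close>

lemma nu_singleton: "nu M rep {u} = 0"
proof -
  have "nu M rep {u} \<le> 0 + ennreal e" if "e > 0" for e
  proof -
    have "\<forall>\<^sub>F D in small_sets M. norm (restr M rep D u) < e"
      by (rule order_tendstoD(2)[OF absolutely_continuous_norm that])
    then have "nu M rep {u} \<le> ennreal e"
      by (intro nu_leI, elim eventually_mono) auto
    then show ?thesis by simp
  qed
  then have "nu M rep {u} \<le> 0" by (rule ennreal_le_epsilon)
  then show ?thesis by simp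
qed

lemma nu_constant: "nu M rep ((\<lambda>x. u) ` U) = 0"
  using nu_mono[of "(\<lambda>x. u) ` U" "{u}"] nu_singleton[of u] by auto

lemma nu_translate: "nu M rep ((+) u ` U) = nu M rep U"
proof (rule antisym)
  show "nu M rep ((+) u ` U) \<le> nu M rep U"
    using nu_add[of "\<lambda>_. u" id U] by (simp add: nu_constant)
  show "nu M rep U \<le> nu M rep ((+) u ` U)"
    using nu_diff[of id "\<lambda>_. u" "(+) u ` U"] by (simp add: nu_constant image_image)
qed

text \<open>Restriction is linear, so pushing a nonzero \<open>u\<close> of the ball radially out to
  the sphere multiplies the norm of its restriction by a factor at least 1.\<close>

lemma nu_cball_eq_nu_sphere:
  assumes "\<rho> > 0"
  shows "nu M rep (cball 0 \<rho>) = nu M rep (sphere 0 \<rho>)"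
proof (rule antisym)
  show "nu M rep (cball 0 \<rho>) \<le> nu M rep (sphere 0 \<rho>)"
    unfolding nu_def
  proof (intro Limsup_mono eventually_small_setsI SUP_least)
    fix D and u :: 'e
    assume D: "D \<in> sets M" and u: "u \<in> cball 0 \<rho>"
    show "ennreal (norm (restr M rep D u)) \<le> (SUP u\<in>sphere 0 \<rho>. ennreal (norm (restr M rep D u)))"
    proof (cases "u = 0")
      case True
      \<comment> \<open>The zero element has no radial projection, but it contributes 0; this also
        covers an empty sphere in the zero space.\<close>
      then show ?thesis
        using norm_restr_le[OF D, of u] by (simp add: ennreal_neg)
    next
      case False
      define v where "v = (\<rho> / norm u) *\<^sub>R u"
      have "norm (restr M rep D u) \<le> (\<rho> / norm u) * norm (restr M rep D u)"
        using u False mult_right_mono[of 1 "\<rho> / norm u" "norm (restr M rep D u)"] by simp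
      also have "\<dots> = norm (restr M rep D v)"
        using assms by (simp add: v_def restr_scaleR[OF D])
      finally show ?thesis
        using False assms by (intro SUP_upper2[of v] ennreal_leI) (auto simp: v_def)
    qed
  qed
qed (rule nu_mono, auto)

section \<open>Homogeneous operators: from spheres to bounded sets\<close>

text \<open>
  If \<open>T\<close> has \<open>\<nu>\<close>-value zero on every sphere, Baire's theorem, applied to the radii in
  \<open>[1, 2]\<close> at which smallness of \<open>D\<close> of order \<open>1/m\<close> suffices, makes this uniform on a
  spherical layer.
\<close>

lemma nu_layer_le:
  fixes T :: "'x::real_normed_vector \<Rightarrow> 'e"
  assumes cont: "continuous_on UNIV T"
    and sph: "\<And>t. t > 0 \<Longrightarrow> nu M rep (T ` sphere 0 t) = 0"
    and \<delta>: "\<delta> > 0"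
  obtains a b where "1 \<le> a" "a < b" "nu M rep (T ` {u. a \<le> norm u \<and> norm u \<le> b}) \<le> ennreal \<delta>"
proof -
  define C where "C m = {t\<in>{1..2::real}. \<forall>D\<in>{D\<in>sets M. emeasure M D < ennreal (inverse (real (Suc m)))}.
      \<forall>v\<in>sphere 0 1. norm (restr M rep D (T (t *\<^sub>R v))) \<le> \<delta>}" for m
  \<comment> \<open>For fixed \<open>D\<close> and direction \<open>v\<close> the condition is
    closed in \<open>t\<close> by continuity of \<open>T\<close> and of the restriction;
    \<open>C m\<close> is an intersection of such conditions.\<close>
  have closed: "closed (C m)" for m
  proof -
    have "C m = {1..2} \<inter> (\<Inter>D\<in>{D\<in>sets M. emeasure M D < ennreal (inverse (real (Suc m)))}.
      \<Inter>v\<in>sphere 0 1. {t. norm (restr M rep D (T (t *\<^sub>R v))) \<le> \<delta>})"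
      by (auto simp: C_def)
    also have "closed \<dots>"
    proof (intro closed_Int closed_INT ballI closed_Collect_le continuous_intros closed_atLeastAtMost)
      fix D and v :: 'x assume "D \<in> {D\<in>sets M. emeasure M D < ennreal (inverse (real (Suc m)))}"
      then have "bounded_linear (restr M rep D)" by (simp add: bounded_linear_restr)
      moreover have "continuous_on UNIV (\<lambda>t. T (t *\<^sub>R v))"
        by (intro continuous_on_compose2[OF cont] continuous_intros) auto
      ultimately show "continuous_on UNIV (\<lambda>t. restr M rep D (T (t *\<^sub>R v)))"
        by (rule bounded_linear.continuous_on)
    qed
    finally show ?thesis .
  qed
  have Un: "(\<Union>m. C m) = {1..2}"
  proof (rule antisym)
    show "{1..2} \<subseteq> (\<Union>m. C m)"
    proof
      fix t :: real assume t: "t \<in> {1..2}"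
      then have "nu M rep (T ` sphere 0 t) < ennreal \<delta>" using sph \<delta> by auto
      then obtain d where d: "d > 0" "\<And>D u. D \<in> sets M \<Longrightarrow> emeasure M D < d \<Longrightarrow>
          u \<in> sphere 0 t \<Longrightarrow> norm (restr M rep D (T u)) \<le> \<delta>"
        unfolding eventually_small_sets by (auto dest!: nu_lessD simp: eventually_small_sets)
      obtain m where m: "ennreal (inverse (real (Suc m))) < d"
      proof -
        \<comment> \<open>The threshold \<open>d\<close> may be infinite, so a positive real below
          it is chosen before the Archimedean property is applied.\<close>
        obtain x where x: "0 < x" "x < d" using dense[OF d(1)] by blast
        then obtain e where e: "0 < e" "ennreal e < d"
          by (cases x) auto
        obtain m where "inverse (real (Suc m)) < e" using reals_Archimedean e(1) by blast
        then have "ennreal (inverse (real (Suc m))) < ennreal e" by (intro ennreal_lessI e)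
        with e show ?thesis by (intro that[of m]) (rule order.strict_trans)
      qed
      have "t \<in> C m"
        unfolding C_def using t m by (auto intro!: d(2) intro: order.strict_trans)
      then show "t \<in> (\<Union>m. C m)" by blast
    qed
  qed (auto simp: C_def)
  \<comment> \<open>Otherwise the countable union of the closed sets \<open>C m\<close> would have
    empty interior, but it is \<open>{1..2}\<close>.\<close>
  have "\<exists>m. interior (C m) \<noteq> {}"
  proof (rule ccontr)
    assume "\<not> ?thesis"
    then have "(euclidean :: real topology) interior_of \<Union>(range C) = {}"
      using closed by (intro Baire_category_alt) (auto simp: completely_metrizable_space_euclidean)
    then show False using Un by simp
  qed
  then obtain m t e where te: "e > 0" "ball t e \<subseteq> C m"
    by (metis all_not_in_conv mem_interior)
  \<comment> \<open>Half the radius keeps the closed interval from \<open>t\<close> to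
    \<open>b\<close> inside the open ball.\<close>
  define b where "b = t + e / 2"
  have sub: "{t..b} \<subseteq> C m" using te by (auto simp: b_def dist_real_def subset_iff)
  show ?thesis
  proof (rule that[of t b])
    have "t \<in> C m" using te by auto
    then show "1 \<le> t" by (simp add: C_def)
    show "t < b" using te by (simp add: b_def)
    show "nu M rep (T ` {u. t \<le> norm u \<and> norm u \<le> b}) \<le> ennreal \<delta>"
    proof (rule nu_leI, unfold eventually_small_sets, intro exI[of _ "ennreal (inverse (real (Suc m)))"]
        conjI ballI impI)
      fix D x assume D: "D \<in> sets M" "emeasure M D < ennreal (inverse (real (Suc m)))"
        and "x \<in> T ` {u. t \<le> norm u \<and> norm u \<le> b}"
      then obtain u where u: "t \<le> norm u" "norm u \<le> b" "x = T u" by auto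
      with \<open>1 \<le> t\<close> have "u \<noteq> 0" by auto
      \<comment> \<open>Write \<open>u\<close> as radius times direction: all radii of the layer
        share the index \<open>m\<close>, hence the same threshold for the measure of
        \<open>D\<close>.\<close>
      moreover have "norm u \<in> C m" using u sub by auto
      moreover have "u /\<^sub>R norm u \<in> sphere 0 1" using \<open>u \<noteq> 0\<close> by simp
      ultimately have "norm (restr M rep D (T (norm u *\<^sub>R (u /\<^sub>R norm u)))) \<le> \<delta>"
        using D unfolding C_def by blast
      with \<open>u \<noteq> 0\<close> u show "norm (restr M rep D x) \<le> \<delta>" by simp
    qed simp
  qed
qed

text \<open>
  For the layer \<open>a \<le> \<parallel>u\<parallel> \<le> b\<close> of the preceding lemma, the ball of radius \<open>b\<close> is the union of
  that layer and of its own multiple by \<open>q = a/b < 1\<close>. Since homogeneity lowers the finite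
  \<open>\<nu>\<close>-value by the factor \<open>q\<^sup>k\<close> on the latter, only the layer counts.
\<close>

lemma nu_homogeneous_eq_0:
  fixes T :: "'x::real_normed_vector \<Rightarrow> 'e"
  assumes cont: "continuous_on UNIV T" and k: "k > 0"
    and hom: "\<And>U \<rho>. \<rho> > 0 \<Longrightarrow> nu M rep (T ` ((*\<^sub>R) \<rho> ` U)) = ennreal (\<rho> powr k) * nu M rep (T ` U)"
    and sph: "nu M rep (T ` sphere 0 1) = 0"
    and U: "bounded U"
  shows "nu M rep (T ` U) = 0"
proof -
  have scale: "(*\<^sub>R) \<rho> ` cball (0::'x) 1 = cball 0 \<rho>" "(*\<^sub>R) \<rho> ` sphere (0::'x) 1 = sphere 0 \<rho>" if "\<rho> > 0" for \<rho>
    using that cball_scale[of \<rho> "0::'x" 1] sphere_scale[of \<rho> "0::'x" 1] by simp_all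
  have ball: "nu M rep (T ` cball 0 \<rho>) = ennreal (\<rho> powr k) * nu M rep (T ` cball 0 1)" if "\<rho> > 0" for \<rho>
    using hom[OF that, of "cball 0 1"] scale[OF that] by simp
  have sph': "nu M rep (T ` sphere 0 \<rho>) = 0" if "\<rho> > 0" for \<rho>
    using hom[OF that, of "sphere 0 1"] scale[OF that] sph by simp
  \<comment> \<open>Continuity at 0 bounds \<open>T\<close> on some small ball, and homogeneity
    carries finiteness to the unit ball. An infinite value would defeat the contraction argument
    below.\<close>
  have fin: "nu M rep (T ` cball 0 1) < top"
  proof -
    have "continuous (at 0) T" using cont by (simp add: continuous_on_eq_continuous_at)
    then obtain d where d: "d > 0" "\<And>x. dist x 0 < d \<Longrightarrow> dist (T x) (T 0) < 1"
      unfolding continuous_at_eps_delta by (metis zero_less_one)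
    have "T ` cball 0 (d / 2) \<subseteq> cball 0 (norm (T 0) + 1)"
    proof (safe, simp)
      fix x :: 'x assume "norm x * 2 \<le> d"
      then have "norm (T x - T 0) < 1" using d(1) d(2)[of x] by (simp add: dist_norm)
      then show "norm (T x) \<le> norm (T 0) + 1" using norm_triangle_ineq2[of "T x" "T 0"] by linarith
    qed
    then have "nu M rep (T ` cball 0 (d / 2)) \<le> ennreal (norm (T 0) + 1)" by (rule nu_bounded_le)
    also have "\<dots> < top" by simp
    finally show ?thesis
      using d(1) ball[of "d / 2"] by (auto simp: ennreal_mult_less_top)
  qed
  have "nu M rep (T ` cball 0 1) \<le> 0 + ennreal \<delta>" if \<delta>: "\<delta> > 0" for \<delta>
  proof -
    obtain a b where ab: "1 \<le> a" "a < b" and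
      layer: "nu M rep (T ` {u. a \<le> norm u \<and> norm u \<le> b}) \<le> ennreal \<delta>"
      using nu_layer_le[OF cont sph' \<delta>] by blast
    have bfin: "nu M rep (T ` cball 0 b) < top"
      using ball[of b] fin ab by (simp add: ennreal_mult_less_top)
    then obtain N where N: "N \<ge> 0" "nu M rep (T ` cball 0 b) = ennreal N"
      by (cases "nu M rep (T ` cball 0 b)") auto
    have q: "(a / b) powr k < 1"
      using ab k powr_less_mono2[of k "a / b" 1] by simp
    have eq: "(*\<^sub>R) (a / b) ` cball (0::'x) b = cball 0 a"
      using cball_scale[of "a / b" "0::'x" b] ab by simp
    have "cball 0 b \<subseteq> {u. a \<le> norm u \<and> norm u \<le> b} \<union> cball (0::'x) a" by auto
    then have "T ` cball 0 b \<subseteq> T ` {u. a \<le> norm u \<and> norm u \<le> b} \<union> T ` cball 0 a"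
      by blast
    from nu_mono[OF this]
    have "nu M rep (T ` cball 0 b) \<le>
        max (nu M rep (T ` {u. a \<le> norm u \<and> norm u \<le> b})) (nu M rep (T ` cball 0 a))"
      using nu_Un order_trans by blast
    also have "nu M rep (T ` cball 0 a) = ennreal ((a / b) powr k * N)"
      using hom[of "a / b" "cball 0 b"] ab eq N by (simp add: ennreal_mult)
    also have "max (nu M rep (T ` {u. a \<le> norm u \<and> norm u \<le> b})) (ennreal ((a / b) powr k * N))
        \<le> max (ennreal \<delta>) (ennreal ((a / b) powr k * N))"
      by (rule max.mono[OF layer order_refl])
    finally have "N \<le> max \<delta> ((a / b) powr k * N)"
      using N \<delta> by (simp add: le_max_iff_disj ennreal_le_iff)
    \<comment> \<open>For positive \<open>N\<close> the second term of the maximum is too small, so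
      the bound must come from \<open>\<delta>\<close>.\<close>
    moreover have "(a / b) powr k * N < N" if "N > 0" using that q by simp
    ultimately have "N \<le> \<delta>" using N \<delta>
      by (cases "N > 0") (auto simp: le_max_iff_disj)
    moreover have "T ` cball 0 1 \<subseteq> T ` cball 0 b" using ab by (intro image_mono) auto
    ultimately show ?thesis
      using nu_mono[of "T ` cball 0 1" "T ` cball 0 b"] N by (auto intro: order_trans ennreal_leI)
  qed
  then have "nu M rep (T ` cball 0 1) \<le> 0" by (rule ennreal_le_epsilon)
  moreover obtain \<rho> where "\<rho> > 0" "U \<subseteq> cball 0 \<rho>"
    using U by (auto simp: bounded_pos subset_iff)
  ultimately show ?thesis
    using ball[of \<rho>] nu_mono[of "T ` U" "T ` cball 0 \<rho>"] by auto
qed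

text \<open>The filter \<open>F\<close> stands for radii tending to 0 (with
  \<open>k \<le> 1\<close>) or to infinity (with \<open>k \<ge> 1\<close>); in both cases
  \<open>\<rho> \<le> \<rho> powr k\<close> eventually. Replacing \<open>\<rho>\<close> by
  \<open>\<rho> powr k\<close> on the right lets this factor cancel, and the limit gives the value 0
  on the unit sphere.\<close>

lemma homogeneous_improving:
  fixes T :: "'x::banach \<Rightarrow> 'e" and h :: "real \<Rightarrow> real"
  assumes cont: "continuous_on UNIV T" and k: "k > 0"
    and hom: "\<And>U \<rho>. \<rho> > 0 \<Longrightarrow> nu M rep (T ` ((*\<^sub>R) \<rho> ` U)) = ennreal (\<rho> powr k) * nu M rep (T ` U)"
    and F: "F \<noteq> bot" "\<forall>\<^sub>F \<rho> in F. 0 < \<rho> \<and> \<rho> \<le> \<rho> powr k"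
    and h: "(h \<longlongrightarrow> 0) F"
    and le: "\<forall>\<^sub>F \<rho> in F. nu M rep (T ` sphere 0 \<rho>) \<le> ennreal (h \<rho>) * ennreal \<rho>"
  shows "improving M rep' rep T"
proof -
  have "\<forall>\<^sub>F \<rho> in F. nu M rep (T ` sphere 0 1) \<le> ennreal (h \<rho>)"
    using F(2) le
  proof eventually_elim
    case (elim \<rho>)
    have "ennreal (\<rho> powr k) * nu M rep (T ` sphere 0 1) = nu M rep (T ` sphere 0 \<rho>)"
      using hom[of \<rho> "sphere 0 1"] elim sphere_scale[of \<rho> "0::'x" 1] by simp
    also have "\<dots> \<le> ennreal (h \<rho>) * ennreal \<rho>" by (rule elim)
    also have "\<dots> \<le> ennreal (h \<rho>) * ennreal (\<rho> powr k)"
      using elim by (intro mult_left_mono ennreal_leI) auto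
    finally have "ennreal (\<rho> powr k) * nu M rep (T ` sphere 0 1) \<le> ennreal (\<rho> powr k) * ennreal (h \<rho>)"
      by (simp add: mult.commute)
    then show ?case using elim by (subst (asm) ennreal_mult_le_mult_iff) auto
  qed
  moreover have "((\<lambda>\<rho>. ennreal (h \<rho>)) \<longlongrightarrow> ennreal 0) F" using h by (rule tendsto_ennrealI)
  ultimately have "nu M rep (T ` sphere 0 1) \<le> 0"
    using F(1) by (intro tendsto_lowerbound[where F = F and f = "\<lambda>\<rho>. ennreal (h \<rho>)"]) auto
  then show ?thesis
    unfolding improving_def using nu_homogeneous_eq_0[OF cont k hom] by auto
qed

end

section \<open>Sums of operators between two regular spaces\<close>

locale regular_function_space_pair =
  E: regular_function_space M rep + E1: regular_function_space M rep1
  for M :: "'a measure" and rep :: "'e::banach \<Rightarrow> 'a \<Rightarrow> real" and rep1 :: "'e1::banach \<Rightarrow> 'a \<Rightarrow> real"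
begin

lemma nu_image_le_of_improving:
  assumes "improving M rep rep1 A1" "bounded U" "\<And>u. u \<in> U \<Longrightarrow> f u = A1 u + A0 u"
  shows "nu M rep1 (f ` U) \<le> nu M rep1 (A0 ` U)"
proof -
  have "f ` U = (\<lambda>u. A1 u + A0 u) ` U" using assms(3) by (rule image_cong[OF refl])
  then show ?thesis
    using E1.nu_add[of A1 A0 U] assms(1,2) by (simp add: improving_def)
qed

text \<open>On \<open>U\<close> the principal part is the difference of \<open>f\<close> and
  \<open>A0\<close>, and \<open>nu\<close> is subadditive for differences too.\<close>

lemma nu_image_le_add:
  assumes "\<And>u. u \<in> U \<Longrightarrow> f u = A1 u + A0 u"
  shows "nu M rep1 (A1 ` U) \<le> nu M rep1 (f ` U) + nu M rep1 (A0 ` U)"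
proof -
  have "A1 ` U = (\<lambda>u. f u - A0 u) ` U" using assms by (intro image_cong) auto
  then show ?thesis using E1.nu_diff[of f A0 U] by simp
qed

section \<open>Local condensing at a point\<close>

text \<open>The function \<open>l\<close> belonging to \<open>A0\<close> serves for \<open>f\<close>
  as well. One estimate for arbitrary subsets of the ball gives both claims, because ball and sphere
  have the same \<open>nu\<close>.\<close>

lemma locally_condensing_if_improving:
  assumes f: "\<delta> > 0" "\<And>u. norm u < \<delta> \<Longrightarrow> f (u1 + u) = A1 u + A0 u"
    and A0: "locally_strongly_condensing M rep rep1 0 A0"
    and A1: "improving M rep rep1 A1"
  shows "locally_strongly_condensing M rep rep1 u1 f"
    and "locally_strongly_condensing_on_spheres M rep rep1 u1 f"
proof -
  obtain r1 l where l: "r1 > 0" "\<forall>r\<in>{0..r1}. l r \<ge> 0" "(l \<longlongrightarrow> 0) (at_right 0)"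
    "\<And>\<rho> r. 0 < \<rho> \<Longrightarrow> \<rho> < r \<Longrightarrow> r < r1 \<Longrightarrow>
      nu M rep1 (A0 ` cball 0 \<rho>) \<le> ennreal (l r) * nu M rep (cball 0 \<rho>)"
    using A0 by (auto simp: locally_strongly_condensing_def)
  define r0 where "r0 = min r1 \<delta>"
  have bd: "nu M rep1 (f ` ((+) u1 ` U)) \<le> ennreal (l r) * nu M rep (cball 0 \<rho>)"
    if r: "0 < \<rho>" "\<rho> < r" "r < r0" and U: "U \<subseteq> cball 0 \<rho>" for \<rho> r U
  proof -
    have "nu M rep1 (f ` ((+) u1 ` U)) = nu M rep1 ((\<lambda>u. f (u1 + u)) ` U)"
      by (simp add: image_image)
    also have "\<dots> \<le> nu M rep1 (A0 ` U)"
      using r U bounded_subset[OF bounded_cball U] f(2)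
      by (intro nu_image_le_of_improving[OF A1]) (auto simp: r0_def subset_iff)
    also have "\<dots> \<le> nu M rep1 (A0 ` cball 0 \<rho>)"
      using U by (intro E1.nu_mono image_mono)
    also have "\<dots> \<le> ennreal (l r) * nu M rep (cball 0 \<rho>)"
      using l(4) r by (simp add: r0_def)
    finally show ?thesis .
  qed
  have "nu M rep1 (f ` ((+) u1 ` cball 0 \<rho>)) \<le> ennreal (l r) * nu M rep (cball 0 \<rho>)"
    "nu M rep1 (f ` ((+) u1 ` sphere 0 \<rho>)) \<le> ennreal (l r) * nu M rep (sphere 0 \<rho>)"
    if "0 < \<rho>" "\<rho> < r" "r < r0" for \<rho> r
    using bd[OF that order_refl] bd[OF that sphere_cball] that
    by (simp_all only: E.nu_cball_eq_nu_sphere)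
  moreover have "r0 > 0" "\<forall>r\<in>{0..r0}. l r \<ge> 0" using l f by (auto simp: r0_def)
  ultimately show "locally_strongly_condensing M rep rep1 u1 f"
      "locally_strongly_condensing_on_spheres M rep rep1 u1 f"
    unfolding locally_strongly_condensing_def locally_strongly_condensing_on_spheres_def E.nu_translate
    using l(3) by blast+
qed

lemma improving_if_locally_condensing_on_spheres:
  fixes k :: real
  assumes cont: "continuous_on UNIV A1"
    and f: "\<delta> > 0" "\<And>u. norm u < \<delta> \<Longrightarrow> f (u1 + u) = A1 u + A0 u"
    and A0: "locally_strongly_condensing M rep rep1 0 A0"
    and k: "0 < k" "k \<le> 1"
    and hom: "\<And>U \<rho>. \<rho> > 0 \<Longrightarrow> nu M rep1 (A1 ` ((*\<^sub>R) \<rho> ` U)) = ennreal (\<rho> powr k) * nu M rep1 (A1 ` U)"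
    and sph: "locally_strongly_condensing_on_spheres M rep rep1 u1 f"
  shows "improving M rep rep1 A1"
proof -
  obtain r0 l0 where l0: "r0 > 0" "\<forall>r\<in>{0..r0}. l0 r \<ge> 0" "(l0 \<longlongrightarrow> 0) (at_right 0)"
    "\<And>\<rho> r. 0 < \<rho> \<Longrightarrow> \<rho> < r \<Longrightarrow> r < r0 \<Longrightarrow>
      nu M rep1 (A0 ` cball 0 \<rho>) \<le> ennreal (l0 r) * nu M rep (cball 0 \<rho>)"
    using A0 by (auto simp: locally_strongly_condensing_def)
  obtain r1 l where l: "r1 > 0" "\<forall>r\<in>{0..r1}. l r \<ge> 0" "(l \<longlongrightarrow> 0) (at_right 0)"
    "\<And>\<rho> r. 0 < \<rho> \<Longrightarrow> \<rho> < r \<Longrightarrow> r < r1 \<Longrightarrow>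
      nu M rep1 ((\<lambda>u. f (u1 + u)) ` sphere 0 \<rho>) \<le> ennreal (l r) * nu M rep (sphere 0 \<rho>)"
    using sph unfolding locally_strongly_condensing_on_spheres_def E.nu_translate image_image
    by blast
  \<comment> \<open>Both condensing estimates on radius \<open>\<rho>\<close> ask for a strictly
    larger \<open>r\<close>; the choice \<open>2 * \<rho>\<close> still tends to 0.\<close>
  define h where "h \<rho> = l (2 * \<rho>) + l0 (2 * \<rho>)" for \<rho>
  have dbl: "filterlim (\<lambda>\<rho>::real. 2 * \<rho>) (at_right 0) (at_right 0)"
    unfolding filterlim_at_right_to_0[symmetric] filterlim_at
    by (auto intro!: tendsto_eq_intros simp: eventually_at_right_less eventually_at_filter)
  have h: "(h \<longlongrightarrow> 0) (at_right 0)"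
    unfolding h_def
    using tendsto_add[OF filterlim_compose[OF l(3) dbl] filterlim_compose[OF l0(3) dbl]] by simp
  \<comment> \<open>The first two entries make \<open>2 * \<rho>\<close> admissible,
    \<open>\<delta>\<close> secures the decomposition, and 1 secures
    \<open>\<rho> \<le> \<rho> powr k\<close>.\<close>
  define m where "m = Min {r0 / 2, r1 / 2, \<delta>, 1}"
  have "m > 0" using l(1) l0(1) f(1) by (simp add: m_def)
  then have small: "\<forall>\<^sub>F \<rho> in at_right 0. 0 < \<rho> \<and> \<rho> < m"
    unfolding eventually_at_right_field by (intro exI[of _ m]) auto
  have le: "nu M rep1 (A1 ` sphere 0 \<rho>) \<le> ennreal (h \<rho>) * ennreal \<rho>" if \<rho>: "0 < \<rho> \<and> \<rho> < m" for \<rho>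
  proof -
    have \<rho>': "0 < \<rho>" "\<rho> < 2 * \<rho>" "2 * \<rho> < r0" "2 * \<rho> < r1" "\<rho> < \<delta>"
      using \<rho> by (auto simp: m_def)
    have "nu M rep1 (A1 ` sphere 0 \<rho>)
        \<le> nu M rep1 ((\<lambda>u. f (u1 + u)) ` sphere 0 \<rho>) + nu M rep1 (A0 ` sphere 0 \<rho>)"
      using \<rho>' f(2) by (intro nu_image_le_add) auto
    also have "\<dots> \<le> ennreal (l (2 * \<rho>)) * nu M rep (sphere 0 \<rho>) + ennreal (l0 (2 * \<rho>)) * nu M rep (cball 0 \<rho>)"
    proof (rule add_mono)
      show "nu M rep1 (A0 ` sphere 0 \<rho>) \<le> ennreal (l0 (2 * \<rho>)) * nu M rep (cball 0 \<rho>)"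
        using \<rho>' by (intro order_trans[OF E1.nu_mono l0(4)]) auto
    qed (use l(4) \<rho>' in auto)
    also have "\<dots> \<le> ennreal (l (2 * \<rho>)) * ennreal \<rho> + ennreal (l0 (2 * \<rho>)) * ennreal \<rho>"
      by (intro add_mono mult_left_mono E.nu_bounded_le) auto
    also have "\<dots> = ennreal (h \<rho>) * ennreal \<rho>"
      using l(2) l0(2) \<rho>' by (simp add: h_def ennreal_plus distrib_right)
    finally show ?thesis .
  qed
  have "\<rho> \<le> \<rho> powr k" if "0 < \<rho> \<and> \<rho> < m" for \<rho>
    using powr_mono'[of k 1 \<rho>] that k by (simp add: m_def)
  then show ?thesis
    using le
    by (intro E1.homogeneous_improving[OF cont k(1) hom _ _ h] eventually_mono[OF small]) auto
qed

text \<open>The sphere lies in the ball and has the same \<open>nu\<close>, so the same function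
  \<open>l\<close> works.\<close>

lemma spheres_if_locally_condensing:
  assumes "locally_strongly_condensing M rep rep1 u1 f"
  shows "locally_strongly_condensing_on_spheres M rep rep1 u1 f"
proof -
  obtain r1 l where l: "r1 > 0" "\<forall>r\<in>{0..r1}. l r \<ge> 0" "(l \<longlongrightarrow> 0) (at_right (0::real))"
    "\<And>\<rho> r. 0 < \<rho> \<Longrightarrow> \<rho> < r \<Longrightarrow> r < r1 \<Longrightarrow>
      nu M rep1 (f ` ((+) u1 ` cball 0 \<rho>)) \<le> ennreal (l r) * nu M rep (cball 0 \<rho>)"
    using assms unfolding locally_strongly_condensing_def E.nu_translate by blast
  have "nu M rep1 (f ` ((+) u1 ` sphere 0 \<rho>)) \<le> ennreal (l r) * nu M rep (sphere 0 \<rho>)"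
    if "0 < \<rho>" "\<rho> < r" "r < r1" for \<rho> r
  proof -
    have "nu M rep1 (f ` ((+) u1 ` sphere 0 \<rho>)) \<le> nu M rep1 (f ` ((+) u1 ` cball 0 \<rho>))"
      by (intro E1.nu_mono image_mono) auto
    also have "\<dots> \<le> ennreal (l r) * nu M rep (sphere 0 \<rho>)"
      using l(4)[OF that] that by (simp add: E.nu_cball_eq_nu_sphere)
    finally show ?thesis .
  qed
  with l(1-3) show ?thesis
    unfolding locally_strongly_condensing_on_spheres_def E.nu_translate by blast
qed

section \<open>Strong condensing at infinity\<close>

text \<open>An interlayer is bounded, so \<open>A1\<close> contributes nothing on it, and beyond
  radius \<open>R\<close> the decomposition of \<open>f\<close> holds throughout it.\<close>

lemma condensing_at_infinity_if_improving:
  assumes f: "\<And>u. norm u > R \<Longrightarrow> f u = A1 u + A0 u"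
    and A0: "strongly_condensing_at_infinity_on_interlayers M rep rep1 A0"
    and A1: "improving M rep rep1 A1"
  shows "strongly_condensing_at_infinity_on_interlayers M rep rep1 f"
proof -
  obtain R0 l where l: "R0 > 0" "\<forall>r\<in>{R0..}. l r \<ge> 0" "(l \<longlongrightarrow> 0) at_top"
    "\<And>R1 R2. R2 > R1 \<Longrightarrow> R1 > R0 \<Longrightarrow> nu M rep1 (A0 ` (cball 0 R2 - cball 0 R1))
      \<le> ennreal (l R1) * nu M rep (cball 0 R2 - cball 0 R1)"
    using A0 unfolding strongly_condensing_at_infinity_on_interlayers_def by blast
  define S where "S = max R0 R"
  have "nu M rep1 (f ` (cball 0 R2 - cball 0 R1)) \<le> ennreal (l R1) * nu M rep (cball 0 R2 - cball 0 R1)"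
    if "R2 > R1" "R1 > S" for R1 R2
  proof -
    have "nu M rep1 (f ` (cball 0 R2 - cball 0 R1)) \<le> nu M rep1 (A0 ` (cball 0 R2 - cball 0 R1))"
      using that f by (intro nu_image_le_of_improving[OF A1] bounded_diff) (auto simp: S_def)
    also have "\<dots> \<le> ennreal (l R1) * nu M rep (cball 0 R2 - cball 0 R1)"
      using l(4) that by (simp add: S_def)
    finally show ?thesis .
  qed
  moreover have "S > 0" "\<forall>r\<in>{S..}. l r \<ge> 0" using l by (auto simp: S_def)
  ultimately show ?thesis
    unfolding strongly_condensing_at_infinity_on_interlayers_def using l(3) by blast
qed

text \<open>The outer sphere belongs to the interlayer, while the interlayer lies in the ball of
  radius \<open>R2\<close>, whose \<open>nu\<close> is that of its sphere.\<close>

lemma spheres_if_condensing_at_infinity: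
  assumes "strongly_condensing_at_infinity_on_interlayers M rep rep1 f"
  shows "strongly_condensing_at_infinity_on_spheres M rep rep1 f"
proof -
  obtain S l where l: "S > 0" "\<forall>r\<in>{S..}. l r \<ge> 0" "(l \<longlongrightarrow> 0) (at_top :: real filter)"
    "\<And>R1 R2. R2 > R1 \<Longrightarrow> R1 > S \<Longrightarrow> nu M rep1 (f ` (cball 0 R2 - cball 0 R1))
      \<le> ennreal (l R1) * nu M rep (cball 0 R2 - cball 0 R1)"
    using assms unfolding strongly_condensing_at_infinity_on_interlayers_def by blast
  have "nu M rep1 (f ` sphere 0 R2) \<le> ennreal (l R1) * nu M rep (sphere 0 R2)"
    if "R2 > R1" "R1 > S" for R1 R2
  proof -
    have "nu M rep1 (f ` sphere 0 R2) \<le> nu M rep1 (f ` (cball 0 R2 - cball 0 R1))"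
      using that by (intro E1.nu_mono image_mono) auto
    also have "\<dots> \<le> ennreal (l R1) * nu M rep (cball 0 R2 - cball 0 R1)"
      using l(4) that by simp
    also have "\<dots> \<le> ennreal (l R1) * nu M rep (cball 0 R2)"
      by (intro mult_left_mono E.nu_mono) auto
    also have "nu M rep (cball 0 R2) = nu M rep (sphere 0 R2)"
      using that l(1) by (intro E.nu_cball_eq_nu_sphere) simp
    finally show ?thesis .
  qed
  with l(1-3) show ?thesis
    unfolding strongly_condensing_at_infinity_on_spheres_def by blast
qed

lemma improving_if_condensing_at_infinity_on_spheres:
  fixes k :: real
  assumes cont: "continuous_on UNIV A1"
    and f: "\<And>u. norm u > R \<Longrightarrow> f u = A1 u + A0 u"
    and A0: "strongly_condensing_at_infinity_on_interlayers M rep rep1 A0"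
    and k: "k \<ge> 1"
    and hom: "\<And>U \<rho>. \<rho> > 0 \<Longrightarrow> nu M rep1 (A1 ` ((*\<^sub>R) \<rho> ` U)) = ennreal (\<rho> powr k) * nu M rep1 (A1 ` U)"
    and sph: "strongly_condensing_at_infinity_on_spheres M rep rep1 f"
  shows "improving M rep rep1 A1"
proof -
  obtain S0 l0 where l0: "S0 > 0" "\<forall>r\<in>{S0..}. l0 r \<ge> 0" "(l0 \<longlongrightarrow> 0) (at_top :: real filter)"
    "\<And>R1 R2. R2 > R1 \<Longrightarrow> R1 > S0 \<Longrightarrow> nu M rep1 (A0 ` sphere 0 R2) \<le> ennreal (l0 R1) * nu M rep (sphere 0 R2)"
    using spheres_if_condensing_at_infinity[OF A0]
    unfolding strongly_condensing_at_infinity_on_spheres_def by blast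
  obtain S1 l where l: "S1 > 0" "\<forall>r\<in>{S1..}. l r \<ge> 0" "(l \<longlongrightarrow> 0) (at_top :: real filter)"
    "\<And>R1 R2. R2 > R1 \<Longrightarrow> R1 > S1 \<Longrightarrow> nu M rep1 (f ` sphere 0 R2) \<le> ennreal (l R1) * nu M rep (sphere 0 R2)"
    using sph unfolding strongly_condensing_at_infinity_on_spheres_def by blast
  \<comment> \<open>The functions are evaluated at an inner radius strictly below
    \<open>\<rho>\<close>; the choice \<open>\<rho> / 2\<close> still tends to infinity.\<close>
  define h where "h \<rho> = l (\<rho> / 2) + l0 (\<rho> / 2)" for \<rho>
  have half: "filterlim (\<lambda>\<rho>::real. \<rho> / 2) at_top at_top"
    by (rule filterlim_at_top_mult_tendsto_pos[of "\<lambda>_. 1 / 2" "1 / 2", simplified]) (auto intro: filterlim_ident)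
  have h: "(h \<longlongrightarrow> 0) at_top"
    unfolding h_def
    using tendsto_add[OF filterlim_compose[OF l(3) half] filterlim_compose[OF l0(3) half]] by simp
  define m where "m = Max {2 * S0, 2 * S1, R, 1}"
  have large: "\<forall>\<^sub>F \<rho> in at_top. \<rho> > m" by (rule eventually_gt_at_top)
  have le: "nu M rep1 (A1 ` sphere 0 \<rho>) \<le> ennreal (h \<rho>) * ennreal \<rho>" if \<rho>: "\<rho> > m" for \<rho>
  proof -
    have \<rho>': "\<rho> > \<rho> / 2" "\<rho> / 2 > S0" "\<rho> / 2 > S1" "\<rho> > R" "\<rho> > 0"
      using \<rho> by (auto simp: m_def)
    have "nu M rep1 (A1 ` sphere 0 \<rho>) \<le> nu M rep1 (f ` sphere 0 \<rho>) + nu M rep1 (A0 ` sphere 0 \<rho>)"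
      using \<rho>' f by (intro nu_image_le_add) auto
    also have "\<dots> \<le> ennreal (l (\<rho> / 2)) * nu M rep (sphere 0 \<rho>) + ennreal (l0 (\<rho> / 2)) * nu M rep (sphere 0 \<rho>)"
      using l(4) l0(4) \<rho>' by (intro add_mono) auto
    \<comment> \<open>Restriction does not increase norms, so \<open>nu\<close> of a sphere is at
      most its radius.\<close>
    also have "\<dots> \<le> ennreal (l (\<rho> / 2)) * ennreal \<rho> + ennreal (l0 (\<rho> / 2)) * ennreal \<rho>"
      by (intro add_mono mult_left_mono E.nu_bounded_le) auto
    also have "\<dots> = ennreal (h \<rho>) * ennreal \<rho>"
      using l(2) l0(2) \<rho>' by (simp add: h_def ennreal_plus distrib_right)
    finally show ?thesis .
  qed
  have "0 < \<rho> \<and> \<rho> \<le> \<rho> powr k" if "\<rho> > m" for \<rho>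
    using powr_mono[of 1 k \<rho>] that k by (simp add: m_def)
  then show ?thesis
    using le k
    by (intro E1.homogeneous_improving[OF cont _ hom _ _ h] eventually_mono[OF large]) auto
qed

end

section \<open>The chains of implications closing both equivalences\<close>

theorem theorem3:
  fixes M :: "(real ^ 'n) measure"
    and rep :: "'e::banach \<Rightarrow> real ^ 'n \<Rightarrow> real"
    and rep1 :: "'e1::banach \<Rightarrow> real ^ 'n \<Rightarrow> real"
  assumes "finite_measure M"
    and "continuous_measure M"
    and "regular_function_space M rep"
    and "regular_function_space M rep1"
  shows
    "(\<forall>(u1 :: 'e) (f :: 'e \<Rightarrow> 'e1) (A1 :: 'e \<Rightarrow> 'e1) (A0 :: 'e \<Rightarrow> 'e1).
        continuous_on UNIV f \<and> continuous_on UNIV A1 \<and> continuous_on UNIV A0 \<and>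
        (\<exists>\<delta>>0. \<forall>u. norm u < \<delta> \<longrightarrow> f (u1 + u) = A1 u + A0 u) \<and>
        locally_strongly_condensing M rep rep1 0 A0 \<and>
        (\<exists>k::real. 0 < k \<and> k \<le> 1 \<and>
           (\<forall>U. \<forall>\<rho>>0. nu M rep1 (A1 ` ((*\<^sub>R) \<rho> ` U)) = ennreal (\<rho> powr k) * nu M rep1 (A1 ` U)))
        \<longrightarrow>
        (improving M rep rep1 A1 \<longleftrightarrow> locally_strongly_condensing M rep rep1 u1 f) \<and>
        (improving M rep rep1 A1 \<longleftrightarrow> locally_strongly_condensing_on_spheres M rep rep1 u1 f))
     \<and>
     (\<forall>(f :: 'e \<Rightarrow> 'e1) (A1 :: 'e \<Rightarrow> 'e1) (A0 :: 'e \<Rightarrow> 'e1).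
        continuous_on UNIV f \<and> continuous_on UNIV A1 \<and> continuous_on UNIV A0 \<and>
        (\<exists>R. \<forall>u. norm u > R \<longrightarrow> f u = A1 u + A0 u) \<and>
        strongly_condensing_at_infinity_on_interlayers M rep rep1 A0 \<and>
        (\<exists>k::real. k \<ge> 1 \<and>
           (\<forall>U. \<forall>\<rho>>0. nu M rep1 (A1 ` ((*\<^sub>R) \<rho> ` U)) = ennreal (\<rho> powr k) * nu M rep1 (A1 ` U)))
        \<longrightarrow>
        (improving M rep rep1 A1 \<longleftrightarrow> strongly_condensing_at_infinity_on_interlayers M rep rep1 f) \<and>
        (improving M rep rep1 A1 \<longleftrightarrow> strongly_condensing_at_infinity_on_spheres M rep rep1 f))"
proof -
  interpret regular_function_space_pair M rep rep1
    using assms(3,4) by (simp add: regular_function_space_pair_def)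
  show ?thesis
  proof (intro conjI allI impI; elim conjE exE)
    fix u1 :: 'e and f A1 A0 :: "'e \<Rightarrow> 'e1" and \<delta> k :: real
    assume cont: "continuous_on UNIV A1"
      and f: "\<delta> > 0" "\<forall>u. norm u < \<delta> \<longrightarrow> f (u1 + u) = A1 u + A0 u"
      and A0: "locally_strongly_condensing M rep rep1 0 A0"
      and k: "0 < k" "k \<le> 1"
      and hom: "\<forall>U. \<forall>\<rho>>0. nu M rep1 (A1 ` ((*\<^sub>R) \<rho> ` U)) = ennreal (\<rho> powr k) * nu M rep1 (A1 ` U)"
    note f' = f(1) f(2)[rule_format]
    \<comment> \<open>The weakest condition, the one on spheres, already implies improving; the
      condition on balls reaches it through the spheres.\<close>
    note improving = improving_if_locally_condensing_on_spheres[OF cont f' A0 k hom[rule_format]]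
    show "improving M rep rep1 A1 \<longleftrightarrow> locally_strongly_condensing M rep rep1 u1 f"
      using locally_condensing_if_improving(1)[OF f' A0] spheres_if_locally_condensing improving
      by blast
    show "improving M rep rep1 A1 \<longleftrightarrow> locally_strongly_condensing_on_spheres M rep rep1 u1 f"
      using locally_condensing_if_improving(2)[OF f' A0] improving by blast
  next
    fix f A1 A0 :: "'e \<Rightarrow> 'e1" and R k :: real
    assume cont: "continuous_on UNIV A1"
      and f: "\<forall>u. norm u > R \<longrightarrow> f u = A1 u + A0 u"
      and A0: "strongly_condensing_at_infinity_on_interlayers M rep rep1 A0"
      and k: "k \<ge> 1"
      and hom: "\<forall>U. \<forall>\<rho>>0. nu M rep1 (A1 ` ((*\<^sub>R) \<rho> ` U)) = ennreal (\<rho> powr k) * nu M rep1 (A1 ` U)"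
    note f' = f[rule_format]
    note interlayers = condensing_at_infinity_if_improving[OF f' A0]
    \<comment> \<open>This closes the cycle from improving to interlayers, to spheres and
      back.\<close>
    note improving = improving_if_condensing_at_infinity_on_spheres[OF cont f' A0 k hom[rule_format]]
    show "improving M rep rep1 A1 \<longleftrightarrow> strongly_condensing_at_infinity_on_interlayers M rep rep1 f"
      using interlayers spheres_if_condensing_at_infinity improving by blast
    show "improving M rep rep1 A1 \<longleftrightarrow> strongly_condensing_at_infinity_on_spheres M rep rep1 f"
      using interlayers spheres_if_condensing_at_infinity improving by blast
  qed
qed

end
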